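(* Let $\mathbf{R}\in\mathbb{R}^{d\times d}$ be a symmetric positive semi-definite matrix with $\lambda_1(\mathbf{R})>\lambda_d(\mathbf{R})$, let $1<\kappa_{max}<\kappa(\mathbf{R})$ with $\kappa_{max}$ finite, and let $\mathbf{R}_{RR}=\mathbf{R}+\delta\mathbf{I}_d$ be the ridge regression reconditioned matrix, where $$\delta=\frac{\lambda_1(\mathbf{R})-\lambda_d(\mathbf{R})\kappa_{max}}{\kappa_{max}-1}.$$ Let $\boldsymbol{\Sigma}$ be the diagonal matrix of standard deviations of $\mathbf{R}$, and let $\boldsymbol{\Sigma}_{RR}$ and $\mathbf{C}_{RR}$ be the diagonal matrix of standard deviations and the correlation matrix of $\mathbf{R}_{RR}$. Then $$\boldsymbol{\Sigma}_{RR}=(\boldsymbol{\Sigma}^2+\delta\mathbf{I}_d)^{1/2},\qquad \mathbf{C}_{RR}=\boldsymbol{\Sigma}_{RR}^{-1}\mathbf{R}\,\boldsymbol{\Sigma}_{RR}^{-1}+\delta\,\boldsymbol{\Sigma}_{RR}^{-2}.$$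
   Context: Eigenvalues of a symmetric positive semi-definite matrix $\mathbf{S}\in\mathbb{R}^{d\times d}$ are ordered $\lambda_1(\mathbf{S})\ge\dots\ge\lambda_d(\mathbf{S})\ge 0$. The condition number is $\kappa(\mathbf{S})=\lambda_1(\mathbf{S})/\lambda_d(\mathbf{S})$ if $\mathbf{S}$ is positive definite, and $\kappa(\mathbf{S})=\infty$ if $\mathbf{S}$ is singular. For a symmetric positive semi-definite $\mathbf{S}$, its matrix of standard deviations is the diagonal matrix with $(i,i)$ entry $\sqrt{\mathbf{S}(i,i)}$, and its correlation matrix is the matrix with $(i,j)$ entry $\dfrac{\mathbf{S}(i,j)}{\sqrt{\mathbf{S}(i,i)}\sqrt{\mathbf{S}(j,j)}}$ (when all $\mathbf{S}(i,i)>0$). $\mathbf{I}_d$ is the $d\times d$ identity matrix; the square root of a diagonal matrix with non-negative entries is taken entrywise on the diagonal. *)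

theory Defs
  imports "HOL-Analysis.Analysis" "HOL-Computational_Algebra.Polynomial"
begin

text \<open>The dimension \<open>d\<close> is \<open>CARD('n)\<close> throughout.\<close>

definition pos_semidef :: "real ^ 'n ^ 'n \<Rightarrow> bool" where
  "pos_semidef S \<longleftrightarrow> transpose S = S \<and> (\<forall>v. 0 \<le> v \<bullet> (S *v v))"

definition pos_def :: "real ^ 'n ^ 'n \<Rightarrow> bool" where
  "pos_def S \<longleftrightarrow> transpose S = S \<and> (\<forall>v. v \<noteq> 0 \<longrightarrow> 0 < v \<bullet> (S *v v))"

definition charpoly :: "real ^ 'n ^ 'n \<Rightarrow> real poly" where
  "charpoly S = det (mat [:0, 1:] - map_matrix (\<lambda>a. [:a:]) S)"

text \<open>
  The \<open>k\<close>-th largest eigenvalue, counted with multiplicity, for \<open>1 \<le> k \<le> d\<close>. The list of real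
  roots of the characteristic polynomial has length \<open>d\<close> when \<open>S\<close> is symmetric, the only case used.
\<close>
definition eigval :: "nat \<Rightarrow> real ^ 'n ^ 'n \<Rightarrow> real" where
  "eigval k S = rev (sorted_list_of_multiset (proots (charpoly S))) ! (k - 1)"

text \<open>Meant for positive semi-definite \<open>S\<close>, which is singular exactly when it is not positive definite.\<close>
definition cond_number :: "real ^ 'n ^ 'n \<Rightarrow> ereal" where
  "cond_number S =
     (if pos_def S then ereal (eigval 1 S / eigval CARD('n) S) else \<infinity>)"

definition sd_matrix :: "real ^ 'n ^ 'n \<Rightarrow> real ^ 'n ^ 'n" where
  "sd_matrix S = (\<chi> i j. if i = j then sqrt (S $ i $ i) else 0)"

text \<open>Meant for \<open>S\<close> with positive diagonal entries.\<close>
definition corr_matrix :: "real ^ 'n ^ 'n \<Rightarrow> real ^ 'n ^ 'n" where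
  "corr_matrix S = (\<chi> i j. S $ i $ j / (sqrt (S $ i $ i) * sqrt (S $ j $ j)))"

text \<open>Meant for diagonal \<open>D\<close> with non-negative entries.\<close>
definition diag_sqrt :: "real ^ 'n ^ 'n \<Rightarrow> real ^ 'n ^ 'n" where
  "diag_sqrt D = (\<chi> i j. if i = j then sqrt (D $ i $ i) else 0)"

end

theory Submission
  imports Defs
begin

text \<open>
  Write \<open>\<Sigma>\<close> and \<open>\<Sigma>_RR\<close> for the matrices of standard deviations before and after adding
  \<open>\<delta> I\<close>. Adding \<open>\<delta> I\<close> changes only the diagonal, so both identities are entrywise computations:
  \<open>\<Sigma>_RR\<close> has diagonal entries \<open>sqrt (R $ i $ i + \<delta>)\<close>, and multiplying \<open>R + \<delta> I\<close> on both sides by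
  \<open>\<Sigma>_RR\<^sup>-\<^sup>1\<close> divides the entry \<open>(i, j)\<close> by the two standard deviations. The one thing
  to be secured is that \<open>\<Sigma>_RR\<close> is invertible. Since \<open>R\<close> has non-negative diagonal entries, it is
  enough that \<open>\<delta> > 0\<close>.

  As \<open>\<kappa>_max > 1\<close>, the sign of \<open>\<delta>\<close> is that of \<open>\<lambda>\<^sub>1 - \<lambda>\<^sub>d \<kappa>_max\<close>. For positive definite \<open>R\<close> this number is positive
  because \<open>\<kappa>_max < \<lambda>\<^sub>1 / \<lambda>\<^sub>d\<close> and \<open>\<lambda>\<^sub>d > 0\<close>; for singular \<open>R\<close> because
  \<open>\<lambda>\<^sub>d = 0 < \<lambda>\<^sub>1\<close>. Both cases use what \<open>\<lambda>\<^sub>d\<close> is: the least of the \<open>d\<close> real eigenvalues of \<open>R\<close>. As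
  \<open>\<lambda>\<^sub>d\<close> is read off position \<open>d\<close> of the sorted list of real roots of the characteristic
  polynomial, one has to know that all \<open>d\<close> roots are real, which is the spectral theorem. It is
  proved by maximising the quadratic form on a unit sphere and splitting off the maximiser
  (\<open>symmetric_eigenvector_exists\<close>, \<open>symmetric_orthonormal_eigenvectors\<close>), and translated
  into a factorisation of the characteristic polynomial (\<open>proots_charpoly_symmetric\<close>).
\<close>

section \<open>Orthonormal eigenvectors of a self-adjoint map\<close>

text \<open>
  A maximiser \<open>u\<close> of \<open>v \<bullet> f v\<close> on the unit sphere of \<open>V\<close> is an eigenvector with eigenvalue
  \<open>c = u \<bullet> f u\<close>. By maximality the form \<open>c * (x \<bullet> x) - x \<bullet> f x\<close> is non-negative on \<open>V\<close>. It vanishes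
  at \<open>u\<close>, which is therefore a minimum, yet its derivative there in the direction of the residual
  \<open>w = f u - c u\<close>, which lies in \<open>V\<close> by invariance, is \<open>-2 * (w \<bullet> w)\<close>. Hence \<open>w = 0\<close>.
\<close>
lemma symmetric_eigenvector_exists:
  fixes f :: "'a::euclidean_space \<Rightarrow> 'a"
  assumes lin: "linear f" and sym: "\<And>x y. f x \<bullet> y = x \<bullet> f y"
    and V: "subspace V" and inv: "f ` V \<subseteq> V" and nz: "V \<noteq> {0}"
  obtains u c where "u \<in> V" "norm u = 1" "f u = c *\<^sub>R u"
proof -
  interpret f: linear f by (fact lin)
  obtain v where v: "v \<in> V" "v \<noteq> 0"
    using nz subspace_0[OF V] by blast
  have "(1 / norm v) *\<^sub>R v \<in> sphere 0 1 \<inter> V"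
    using v V by (simp add: subspace_scale)
  moreover have "compact (sphere 0 1 \<inter> V)"
    by (simp add: V closed_subspace compact_Int_closed)
  moreover have "continuous_on (sphere 0 1 \<inter> V) (\<lambda>v. v \<bullet> f v)"
    by (intro continuous_intros linear_continuous_on) (simp add: lin linear_conv_bounded_linear[symmetric])
  ultimately obtain u where u: "u \<in> V" "norm u = 1"
    and max: "\<And>y. y \<in> V \<Longrightarrow> norm y = 1 \<Longrightarrow> y \<bullet> f y \<le> u \<bullet> f u"
    using continuous_attains_sup[of "sphere 0 1 \<inter> V" "\<lambda>v. v \<bullet> f v"] by force
  define c where "c = u \<bullet> f u"
  define w where "w = f u - c *\<^sub>R u"
  have form_nonneg: "0 \<le> c * (x \<bullet> x) - x \<bullet> f x" if x: "x \<in> V" for x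
  proof (cases "x = 0")
    case False
    have "((1 / norm x) *\<^sub>R x) \<bullet> f ((1 / norm x) *\<^sub>R x) \<le> c"
      unfolding c_def using x False V by (intro max) (simp_all add: subspace_scale)
    then have "(x \<bullet> f x) / (norm x)\<^sup>2 \<le> c"
      by (simp add: f.scale power2_eq_square)
    then show ?thesis
      using False by (simp add: divide_le_eq power2_norm_eq_inner)
  qed (simp add: f.zero)
  have w: "w \<in> V"
    unfolding w_def using u inv V by (intro subspace_diff subspace_scale) auto
  define W where "W = w \<bullet> w"
  define K where "K = c * W - w \<bullet> f w"
  have residual: "w \<bullet> f u - c * (w \<bullet> u) = W"
    by (simp add: W_def inner_diff_right flip: inner_scaleR_right)
      (metis inner_diff_right w_def)
  have uu: "u \<bullet> u = 1"
    using u by (simp add: norm_eq_1)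
  have quadratic: "0 \<le> t * (t * K - 2 * W)" for t
  proof -
    have "0 \<le> c * ((u + t *\<^sub>R w) \<bullet> (u + t *\<^sub>R w)) - (u + t *\<^sub>R w) \<bullet> f (u + t *\<^sub>R w)"
      using u w V by (intro form_nonneg subspace_add subspace_scale)
    also have "\<dots> = t\<^sup>2 * K - 2 * t * (w \<bullet> f u - c * (w \<bullet> u))"
      using sym[of u w] uu
      by (simp add: f.add f.scale K_def W_def inner_commute inner_add_left inner_add_right
          c_def[symmetric] algebra_simps power2_eq_square)
    finally show ?thesis
      by (simp add: residual algebra_simps power2_eq_square)
  qed
  have "W = 0"
  proof (rule ccontr)
    assume "W \<noteq> 0"
    then have Wpos: "W > 0"
      by (simp add: W_def)
    \<comment> \<open>At this \<open>t\<close> the linear term dominates: \<open>t * \<bar>K\<bar> < W\<close>.\<close>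
    define t where "t = W / (\<bar>K\<bar> + 1)"
    have t: "t > 0" using Wpos by (simp add: t_def)
    have "t * K \<le> t * \<bar>K\<bar>" using t by (intro mult_left_mono) auto
    also have "\<dots> < t * (\<bar>K\<bar> + 1)" using t by simp
    also have "\<dots> = W" unfolding t_def by simp
    finally have "t * K - 2 * W < 0" using Wpos by simp
    then have "t * (t * K - 2 * W) < 0" using t by (rule mult_pos_neg[rotated])
    with quadratic[of t] show False by simp
  qed
  then have "f u = c *\<^sub>R u"
    by (simp add: W_def w_def)
  with u show thesis by (rule that)
qed

text \<open>
  Induction on the dimension: the orthogonal complement in \<open>V\<close> of an eigenvector is again
  invariant, because \<open>f\<close> is self-adjoint.
\<close>
lemma symmetric_orthonormal_eigenvectors:
  fixes f :: "'a::euclidean_space \<Rightarrow> 'a"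
  assumes lin: "linear f" and sym: "\<And>x y. f x \<bullet> y = x \<bullet> f y"
    and V: "subspace V" and inv: "f ` V \<subseteq> V"
  shows "\<exists>B. B \<subseteq> V \<and> finite B \<and> card B = dim V \<and> pairwise orthogonal B \<and>
             (\<forall>b\<in>B. norm b = 1 \<and> (\<exists>c. f b = c *\<^sub>R b))"
  using V inv
proof (induction "dim V" arbitrary: V)
  case 0
  then show ?case by (intro exI[of _ "{}"]) auto
next
  case (Suc n)
  interpret f: linear f by (fact lin)
  have "V \<noteq> {0}" using Suc.hyps(2) by auto
  then obtain u c where u: "u \<in> V" "norm u = 1" "f u = c *\<^sub>R u"
    using symmetric_eigenvector_exists[OF lin sym Suc.prems] by blast
  define V' where "V' = {y \<in> V. orthogonal u y}"
  have V'_span: "V' = {y \<in> V. \<forall>x\<in>span {u}. orthogonal x y}"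
    by (auto simp: V'_def span_singleton orthogonal_def dest: bspec[of _ _ "1 *\<^sub>R u"])
  have "dim V' + dim (span {u}) = dim V"
    unfolding V'_span using Suc.prems(1) u(1)
    by (intro dim_subspace_orthogonal_to_vectors) (auto intro: span_minimal[THEN subsetD])
  moreover have "dim {u} = 1"
    using u(2) by (auto simp: dim_singleton)
  ultimately have dim: "n = dim V'"
    using Suc.hyps(2) by simp
  have "subspace V'"
    using Suc.prems(1) unfolding V'_def subspace_def by (auto simp: orthogonal_clauses)
  moreover have "f ` V' \<subseteq> V'"
  proof
    fix y assume "y \<in> f ` V'"
    then obtain x where x: "x \<in> V'" "y = f x" by blast
    have "u \<bullet> f x = c * (u \<bullet> x)"
      using sym[of u x] u(3) by simp
    with x Suc.prems(2) show "y \<in> V'"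
      by (auto simp: V'_def orthogonal_def)
  qed
  ultimately obtain B where B: "B \<subseteq> V'" "finite B" "card B = dim V'" "pairwise orthogonal B"
    "\<forall>b\<in>B. norm b = 1 \<and> (\<exists>c. f b = c *\<^sub>R b)"
    using Suc.hyps(1)[OF dim] by blast
  have "u \<notin> V'"
    using u(2) by (auto simp: V'_def orthogonal_def)
  with B have "card (insert u B) = dim V"
    using dim Suc.hyps(2) by (metis card_insert_disjoint subsetD)
  moreover have "pairwise orthogonal (insert u B)"
    using B(1,4) by (auto simp: pairwise_insert V'_def orthogonal_commute)
  ultimately show ?case
    using B u by (intro exI[of _ "insert u B"]) (auto simp: V'_def)
qed

section \<open>The eigenvalues of a symmetric matrix\<close>

definition diag_matrix :: "('n \<Rightarrow> real) \<Rightarrow> real ^ 'n ^ 'n" where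
  "diag_matrix d = (\<chi> i j. if i = j then d i else 0)"

lemma diag_matrix_mult_nth: "(diag_matrix d ** A) $ i $ j = d i * A $ i $ j"
  by (simp add: diag_matrix_def matrix_matrix_mult_def if_distrib[of "\<lambda>x. x * _"] cong: if_cong)

lemma mult_diag_matrix_nth: "(A ** diag_matrix d) $ i $ j = A $ i $ j * d j"
  by (simp add: diag_matrix_def matrix_matrix_mult_def if_distrib[of "\<lambda>x. _ * x"] cong: if_cong)

lemma diag_matrix_mult_diag_matrix:
  "diag_matrix c ** diag_matrix d = diag_matrix (\<lambda>i. c i * d i)"
  by (simp add: vec_eq_iff diag_matrix_mult_nth) (simp add: diag_matrix_def)

lemma diag_matrix_vector_mult: "diag_matrix d *v x = (\<chi> i. d i * x $ i)"
  by (simp add: vec_eq_iff matrix_vector_mult_def diag_matrix_def if_distrib[of "\<lambda>a. a * _"]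
      cong: if_cong)

text \<open>
  Take an orthonormal basis of eigenvectors as the rows of \<open>P\<close>. By symmetry of \<open>S\<close>, the eigenvector
  equations say \<open>P ** S = diag_matrix d ** P\<close>.
\<close>
lemma symmetric_matrix_diagonalization:
  fixes S :: "real ^ 'n ^ 'n"
  assumes S: "transpose S = S"
  obtains P d where "orthogonal_matrix P" "S = transpose P ** diag_matrix d ** P"
proof -
  have sym: "(S *v x) \<bullet> y = x \<bullet> (S *v y)" for x y
    by (metis S dot_lmul_matrix transpose_matrix_vector)
  obtain B where B: "card B = dim (UNIV :: (real ^ 'n) set)" "pairwise orthogonal B" "finite B"
    "\<And>b. b \<in> B \<Longrightarrow> norm b = 1 \<and> (\<exists>c. S *v b = c *\<^sub>R b)"
    using symmetric_orthonormal_eigenvectors[OF matrix_vector_mul_linear[of S] sym subspace_UNIV]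
    by auto
  have "card (UNIV :: 'n set) = card B"
    using B(1) by simp
  then obtain q where q: "bij_betw q (UNIV :: 'n set) B"
    using finite_same_card_bij[OF finite[of "UNIV :: 'n set"] B(3)] by auto
  have "\<forall>i. \<exists>c. S *v q i = c *\<^sub>R q i"
    using B(4) q by (auto simp: bij_betw_def)
  then obtain d where d: "S *v q i = d i *\<^sub>R q i" for i
    by metis
  define P where "P = (\<chi> i. q i)"
  have "norm (q i) = 1" for i
    using q B(4) by (auto simp: bij_betw_def)
  moreover have "orthogonal (q i) (q j)" if "i \<noteq> j" for i j
    using q B(2) that by (auto simp: bij_betw_def pairwise_def inj_on_def)
  ultimately have P: "orthogonal_matrix P"
    by (simp add: orthogonal_matrix_orthonormal_rows P_def row_def)
  have "(P ** S) $ i $ j = (diag_matrix d ** P) $ i $ j" for i j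
  proof -
    have "(P ** S) $ i $ j = (S *v q i) $ j"
      by (subst (2) S[symmetric])
        (simp add: P_def matrix_matrix_mult_def matrix_vector_mult_def transpose_def mult.commute)
    then show ?thesis
      by (simp add: d diag_matrix_mult_nth P_def)
  qed
  then have "P ** S = diag_matrix d ** P"
    by (simp add: vec_eq_iff)
  then have "transpose P ** (P ** S) = transpose P ** (diag_matrix d ** P)"
    by simp
  then have "S = transpose P ** diag_matrix d ** P"
    using P by (simp add: matrix_mul_assoc orthogonal_matrix)
  with P show thesis by (rule that)
qed

lemma poly_charpoly: "poly (charpoly S) x = det (mat x - S)"
  unfolding charpoly_def det_def
  by (simp add: poly_sum poly_prod mat_def if_distrib[of "\<lambda>p. poly p x"] cong: if_cong)

text \<open>
  Polynomials over an infinite field are determined by their values, so the factorisation can be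
  checked on real matrices: conjugation by an orthogonal matrix preserves \<open>det (mat x - S)\<close>.
\<close>
lemma charpoly_diagonalization:
  fixes P :: "real ^ 'n ^ 'n"
  assumes P: "orthogonal_matrix P" and S: "S = transpose P ** diag_matrix d ** P"
  shows "charpoly S = (\<Prod>i\<in>UNIV. [:- d i, 1:])"
proof -
  have "poly (charpoly S) x = poly (\<Prod>i\<in>UNIV. [:- d i, 1:]) x" for x
  proof -
    have PP: "transpose P ** P = mat 1" using P by (simp add: orthogonal_matrix)
    have shift: "(mat x :: real ^ 'n ^ 'n) = x *\<^sub>R mat 1"
      by (simp add: vec_eq_iff mat_def)
    have "mat x = transpose P ** mat x ** P"
      by (simp add: shift PP matrix_scalar_ac flip: scalar_matrix_assoc)
    moreover have "A ** (B - C) = A ** B - A ** C" "(B - C) ** A = B ** A - C ** A"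
      for A B C :: "real ^ 'n ^ 'n"
      by (simp_all add: vec_eq_iff matrix_matrix_mult_def sum_subtractf algebra_simps)
    ultimately have "mat x - S = transpose P ** (mat x - diag_matrix d) ** P"
      unfolding S by simp
    then have "det (mat x - S) = det (transpose P ** P) * det (mat x - diag_matrix d)"
      by (simp add: det_mul del: det_transpose)
    also have "\<dots> = (\<Prod>i\<in>UNIV. x - d i)"
      unfolding PP det_I
      using det_diagonal[of "mat x - diag_matrix d"] by (simp add: mat_def diag_matrix_def)
    finally show ?thesis
      by (simp add: poly_charpoly poly_prod)
  qed
  then show ?thesis
    by (simp add: poly_eq_poly_eq_iff[symmetric] fun_eq_iff)
qed

lemma proots_charpoly_symmetric:
  assumes "orthogonal_matrix P" and "S = transpose P ** diag_matrix d ** P"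
  shows "proots (charpoly S) = image_mset d (mset_set UNIV)"
proof -
  have "proots (\<Prod>i\<in>I. [:- d i, 1:]) = image_mset d (mset_set I)" if "finite I" for I
    using that
  proof induction
    case (insert i I)
    have "(\<Prod>i\<in>I. [:- d i, 1:]) \<noteq> 0"
      using insert.hyps by (simp add: prod_zero_iff)
    with insert show ?case
      by (simp add: proots_mult del: mult_pCons_left mult_pCons_right)
  qed simp
  then show ?thesis
    unfolding charpoly_diagonalization[OF assms] by simp
qed

text \<open>
  A diagonalisation supplies exactly \<open>d\<close> roots, so position \<open>d\<close> is the last one of the decreasing
  list, and the entry there is the least root.
\<close>
lemma eigval_least:
  fixes S :: "real ^ 'n ^ 'n"
  assumes "orthogonal_matrix P" and "S = transpose P ** diag_matrix d ** P"
  shows "eigval CARD('n) S = Min (range d)"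
proof -
  define xs where "xs = sorted_list_of_multiset (proots (charpoly S))"
  have ms: "mset xs = image_mset d (mset_set UNIV)"
    by (simp add: xs_def proots_charpoly_symmetric[OF assms])
  have len: "length xs = CARD('n)"
    using arg_cong[OF ms, of size] by simp
  have set: "set xs = range d"
    using arg_cong[OF ms, of set_mset] by simp
  have sorted: "sorted xs" by (simp add: xs_def)
  obtain y ys where xs: "xs = y # ys"
    using len by (cases xs) auto
  have "eigval CARD('n) S = xs ! 0"
    using len by (simp add: eigval_def xs_def[symmetric] rev_nth)
  also have "\<dots> = Min (range d)"
    using sorted unfolding set[symmetric] xs by (intro Min_eqI[symmetric]) auto
  finally show ?thesis .
qed

section \<open>The shift is positive\<close>

text \<open>
  The witness is row \<open>i\<close> of \<open>P\<close>, an eigenvector for \<open>d i\<close>. Being values of the quadratic form at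
  non-zero vectors, the entries of \<open>d\<close> inherit its sign.
\<close>
lemma diagonalization_eigenvalue:
  fixes P :: "real ^ 'n ^ 'n"
  assumes P: "orthogonal_matrix P" and S: "S = transpose P ** diag_matrix d ** P"
  obtains v where "norm v = 1" "v \<bullet> (S *v v) = d i"
proof
  let ?v = "transpose P *v axis i 1"
  have PP: "P ** transpose P = mat 1"
    using P by (simp add: orthogonal_matrix_def)
  have "?v \<bullet> ?v = axis i 1 \<bullet> (P ** transpose P *v axis i (1::real))"
    by (simp add: dot_lmul_matrix[symmetric] matrix_vector_mul_assoc[symmetric] transpose_matrix_vector)
  then show "norm ?v = 1"
    by (simp add: PP norm_eq_1)
  have "S *v ?v = transpose P *v (diag_matrix d *v (P ** transpose P *v axis i 1))"
    unfolding S by (simp add: matrix_vector_mul_assoc matrix_mul_assoc del: transpose_matrix_vector)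
  also have "\<dots> = d i *\<^sub>R ?v"
  proof -
    have "diag_matrix d *v axis i 1 = d i *\<^sub>R axis i 1"
      by (simp add: vec_eq_iff diag_matrix_vector_mult axis_def)
    then show ?thesis by (simp add: PP matrix_vector_mult_scaleR)
  qed
  finally show "?v \<bullet> (S *v ?v) = d i"
    using \<open>norm ?v = 1\<close> by (simp add: norm_eq_1)
qed

lemma quadratic_form_diagonalization:
  assumes "S = transpose P ** diag_matrix d ** P"
  shows "v \<bullet> (S *v v) = (\<Sum>i\<in>UNIV. d i * ((P *v v) $ i)\<^sup>2)"
proof -
  have "v \<bullet> (S *v v) = (P *v v) \<bullet> (diag_matrix d *v (P *v v))"
    unfolding assms
    by (metis dot_lmul_matrix matrix_vector_mul_assoc transpose_matrix_vector transpose_transpose)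
  then show ?thesis
    by (simp add: diag_matrix_vector_mult inner_vec_def power2_eq_square algebra_simps)
qed

lemma eigval_least_pos_def:
  fixes S :: "real ^ 'n ^ 'n"
  assumes "pos_def S"
  shows "0 < eigval CARD('n) S"
proof -
  have "transpose S = S" using assms by (simp add: pos_def_def)
  then obtain P d where Pd: "orthogonal_matrix P" "S = transpose P ** diag_matrix d ** P"
    by (rule symmetric_matrix_diagonalization)
  have "0 < d i" for i
    using diagonalization_eigenvalue[OF Pd, of i] assms unfolding pos_def_def
    by (metis norm_zero zero_neq_one)
  then show ?thesis
    by (simp add: eigval_least[OF Pd])
qed

text \<open>
  If all eigenvalues were positive, the quadratic form, a sum of squares weighted by them, would be
  positive away from \<open>0\<close>.
\<close>
lemma eigval_least_singular:
  fixes S :: "real ^ 'n ^ 'n"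
  assumes psd: "pos_semidef S" and singular: "\<not> pos_def S"
  shows "eigval CARD('n) S = 0"
proof -
  have "transpose S = S" using psd by (simp add: pos_semidef_def)
  then obtain P d where Pd: "orthogonal_matrix P" "S = transpose P ** diag_matrix d ** P"
    by (rule symmetric_matrix_diagonalization)
  have nonneg: "0 \<le> d i" for i
    using diagonalization_eigenvalue[OF Pd, of i] psd unfolding pos_semidef_def by metis
  obtain v where v: "v \<noteq> 0" "v \<bullet> (S *v v) \<le> 0"
    using psd singular by (auto simp: pos_def_def pos_semidef_def not_less)
  have "transpose P *v (P *v v) = v"
    using Pd(1) by (simp add: matrix_vector_mul_assoc orthogonal_matrix)
  then have "P *v v \<noteq> 0"
    using v(1) by auto
  then obtain i where i: "(P *v v) $ i \<noteq> 0"
    by (auto simp: vec_eq_iff)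
  have "(\<Sum>i\<in>UNIV. d i * ((P *v v) $ i)\<^sup>2) = 0"
    using v(2) nonneg unfolding quadratic_form_diagonalization[OF Pd(2)]
    by (intro antisym sum_nonneg) auto
  then have "d i * ((P *v v) $ i)\<^sup>2 = 0"
    using nonneg by (subst (asm) sum_nonneg_eq_0_iff) auto
  with i have "d i = 0" by simp
  with nonneg have "Min (range d) = 0"
    by (intro Min_eqI) (auto intro: range_eqI[of _ _ i])
  then show ?thesis by (simp add: eigval_least[OF Pd])
qed

lemma ridge_shift_pos:
  fixes R :: "real ^ 'n ^ 'n"
  assumes "pos_semidef R" and "eigval 1 R > eigval CARD('n) R"
    and "1 < \<kappa>" and "ereal \<kappa> < cond_number R"
  shows "0 < (eigval 1 R - eigval CARD('n) R * \<kappa>) / (\<kappa> - 1)"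
proof (cases "pos_def R")
  case True
  with assms show ?thesis
    using eigval_least_pos_def[OF True]
    by (simp add: cond_number_def pos_less_divide_eq mult.commute)
next
  case False
  with assms show ?thesis
    using eigval_least_singular[OF assms(1) False] by simp
qed

section \<open>Standard deviations and correlations after the shift\<close>

lemma pos_semidef_diag_nonneg: "pos_semidef S \<Longrightarrow> 0 \<le> S $ i $ i"
  unfolding pos_semidef_def
  by (drule conjunct2, drule spec[of _ "axis i 1"])
    (simp add: inner_axis' matrix_vector_mult_basis column_def)

lemma matrix_inv_diag_matrix:
  assumes "\<And>i. d i \<noteq> 0"
  shows "matrix_inv (diag_matrix d) = diag_matrix (\<lambda>i. 1 / d i)"
proof -
  have inverse: "diag_matrix d ** diag_matrix (\<lambda>i. 1 / d i) = mat 1"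
    "diag_matrix (\<lambda>i. 1 / d i) ** diag_matrix d = mat 1"
    using assms by (simp_all add: diag_matrix_mult_diag_matrix) (simp_all add: diag_matrix_def mat_def)
  then have "diag_matrix d ** matrix_inv (diag_matrix d) = mat 1 \<and>
      matrix_inv (diag_matrix d) ** diag_matrix d = mat 1"
    unfolding matrix_inv_def
    by (intro someI[of "\<lambda>A. diag_matrix d ** A = mat 1 \<and> A ** diag_matrix d = mat 1"] conjI)
  then have "diag_matrix (\<lambda>i. 1 / d i) ** (diag_matrix d ** matrix_inv (diag_matrix d))
      = diag_matrix (\<lambda>i. 1 / d i)"
    by simp
  then show ?thesis
    by (simp add: matrix_mul_assoc inverse)
qed

theorem theorem3:
  fixes R R_RR \<Sigma> \<Sigma>_RR C_RR :: "real ^ 'n ^ 'n"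
    and \<kappa>_max \<delta> :: real
  assumes "pos_semidef R"
    and "eigval 1 R > eigval CARD('n) R"
    and "1 < \<kappa>_max"
    and "ereal \<kappa>_max < cond_number R"
    and "\<delta> = (eigval 1 R - eigval CARD('n) R * \<kappa>_max) / (\<kappa>_max - 1)"
    and "R_RR = R + \<delta> *\<^sub>R mat 1"
    and "\<Sigma> = sd_matrix R"
    and "\<Sigma>_RR = sd_matrix R_RR"
    and "C_RR = corr_matrix R_RR"
  shows "\<Sigma>_RR = diag_sqrt (\<Sigma> ** \<Sigma> + \<delta> *\<^sub>R mat 1) \<and>
         C_RR = matrix_inv \<Sigma>_RR ** R ** matrix_inv \<Sigma>_RR
           + \<delta> *\<^sub>R (matrix_inv \<Sigma>_RR ** matrix_inv \<Sigma>_RR)"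
proof -
  define s where "s i = sqrt (R $ i $ i + \<delta>)" for i
  have \<delta>: "\<delta> > 0"
    unfolding assms(5) using assms(1-4) by (rule ridge_shift_pos)
  have diag: "0 \<le> R $ i $ i" for i
    using assms(1) by (rule pos_semidef_diag_nonneg)
  have s: "s i \<noteq> 0" for i
    using \<delta> diag[of i] by (simp add: s_def)
  have \<Sigma>: "\<Sigma> = diag_matrix (\<lambda>i. sqrt (R $ i $ i))"
    by (simp add: assms sd_matrix_def diag_matrix_def)
  have \<Sigma>_RR: "\<Sigma>_RR = diag_matrix s"
    by (simp add: assms(6,8) sd_matrix_def diag_matrix_def s_def mat_def vec_eq_iff)
  have "\<Sigma>_RR = diag_sqrt (\<Sigma> ** \<Sigma> + \<delta> *\<^sub>R mat 1)"
    unfolding \<Sigma>_RR \<Sigma> diag_matrix_mult_diag_matrix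
    using diag by (simp add: diag_sqrt_def diag_matrix_def s_def mat_def vec_eq_iff)
  moreover have "C_RR = matrix_inv \<Sigma>_RR ** R ** matrix_inv \<Sigma>_RR
           + \<delta> *\<^sub>R (matrix_inv \<Sigma>_RR ** matrix_inv \<Sigma>_RR)"
  proof -
    have "R_RR $ i $ j / (s i * s j) = R $ i $ j / (s i * s j) + (if i = j then \<delta> / (s i * s i) else 0)"
      for i j
      by (simp add: assms(6) mat_def add_divide_distrib)
    then show ?thesis
      unfolding \<Sigma>_RR matrix_inv_diag_matrix[OF s] diag_matrix_mult_diag_matrix
      by (simp add: vec_eq_iff mult_diag_matrix_nth diag_matrix_mult_nth assms(9) corr_matrix_def)
        (simp add: assms(6) s_def mat_def diag_matrix_def)
  qed
  ultimately show ?thesis by blast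
qed

end
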